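(* Let $E$ be an Archimedean Riesz space with strong order unit $e$ and let $F$ be an Archimedean Riesz space. If $T:E\to F$ is a lattice homomorphism such that $T(\lambda e)=\lambda T(e)$ for each $\lambda\in\mathbb{R}$, then $T$ is linear (that is, $T$ is a Riesz homomorphism).
   Context: A map $T:E\to F$ between Riesz spaces (real vector lattices), not assumed linear, is called a lattice homomorphism if $T(x\vee y)=Tx\vee Ty$ and $T(x\wedge y)=Tx\wedge Ty$ for all $x,y\in E$. A linear lattice homomorphism is called a Riesz homomorphism. A strong order unit of $E$ is an element $e\in E$, $e\ge 0$, such that for every $x\in E$ there is $\lambda\in\mathbb{R}^{+}$ with $|x|\le\lambda e$. *)

theory Defs
  imports Complex_Main "HOL-Library.Lattice_Algebras"
begin

(* The modulus is the library's abs, which this class fixes to be sup x (- x). *)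
class riesz_space = ordered_real_vector + lattice_ab_group_add_abs

class archimedean_riesz_space = riesz_space +
  assumes archimedean: "0 \<le> x \<Longrightarrow> (\<And>n::nat. real n *\<^sub>R x \<le> y) \<Longrightarrow> x = 0"

definition strong_order_unit :: "'a::riesz_space \<Rightarrow> bool" where
  "strong_order_unit e \<longleftrightarrow> 0 \<le> e \<and> (\<forall>x. \<exists>c::real. 0 \<le> c \<and> \<bar>x\<bar> \<le> c *\<^sub>R e)"

definition lattice_homomorphism :: "('a::riesz_space \<Rightarrow> 'b::riesz_space) \<Rightarrow> bool" where
  "lattice_homomorphism T \<longleftrightarrow>
     (\<forall>x y. T (sup x y) = sup (T x) (T y)) \<and> (\<forall>x y. T (inf x y) = inf (T x) (T y))"

definition riesz_homomorphism :: "('a::riesz_space \<Rightarrow> 'b::riesz_space) \<Rightarrow> bool" where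
  "riesz_homomorphism T \<longleftrightarrow> linear T \<and> lattice_homomorphism T"

end

(* Additivity is tested in the totally ordered quotients of the codomain by prime ideals, which
   separate points.  If T x > a u and T y > b u in such a quotient, where u = T e, then for large
   n the steep elements n (x - a e) and n (y - b e) have positive image, because
   g = n (a' e - x) + a' e with a < a' satisfies inf g x \<le> a' e, while sup g (n (x - a e))
   exceeds any given multiple of e.  As the infimum of these steep elements lies below
   n (x + y - (a + b) e) / 2, dually T (x + y) < (a + b) u is impossible. *)
theory Submission imports Defs begin

(* A prime cone C is the set of elements that become nonpositive in the quotient by a prime ideal:
   "x \<in> C" reads "x \<le> 0" and "x - y \<in> C" reads "x \<le> y" in that quotient. *)
definition prime_cone :: "'a::riesz_space set \<Rightarrow> bool" where
  "prime_cone C \<longleftrightarrow> 0 \<in> C \<and> (\<forall>x\<in>C. \<forall>y\<le>x. y \<in> C) \<and> (\<forall>x\<in>C. \<forall>y\<in>C. x + y \<in> C) \<and>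
     (\<forall>x\<in>C. sup x 0 \<in> C) \<and> (\<forall>x y. inf x y \<in> C \<longrightarrow> x \<in> C \<or> y \<in> C)"

section \<open>Separation of points by prime cones\<close>

text \<open>Writing the positive part of z as \<open>z - inf z 0\<close> turns both bounds into
  upper bounds on r + i, where i is a common lower bound of \<open>inf x 0\<close> and
  \<open>inf y 0\<close>. Primeness of maximal cones rests on this.\<close>

lemma le_sup_inf_zero:
  fixes r x y :: "'a::lattice_ab_group_add"
  assumes "r \<le> sup x 0" "r \<le> sup y 0" shows "r \<le> sup (inf x y) 0"
proof -
  define i where "i = inf (inf x y) 0"
  have sup0: "sup z 0 = z - inf z 0" for z :: 'a
    unfolding eq_diff_eq add_eq_inf_sup[of z 0, simplified add.right_neutral, symmetric] ..
  have "i \<le> inf x 0" "i \<le> inf y 0" unfolding i_def by (auto intro: le_infI1)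
  then have "x - inf x 0 \<le> x - i" "y - inf y 0 \<le> y - i" by (simp_all add: diff_left_mono)
  then have "r \<le> x - i" "r \<le> y - i"
    using assms unfolding sup0 by (blast intro: order_trans)+
  then have "r + i \<le> inf x y" by (simp add: le_diff_eq)
  then show ?thesis unfolding sup0 i_def[symmetric] by (simp add: le_diff_eq)
qed

text \<open>Zorn's lemma gives a maximal element among the sets that omit t and satisfy all clauses
  of \<open>prime_cone\<close> but the last. If x and y both lay outside it while
  \<open>inf x y\<close> lay inside, adjoining either one would capture t, and the two resulting
  bounds on t combine to put t into the maximal set itself.\<close>

lemma prime_cone_exists:
  fixes t :: "'a::riesz_space"
  assumes "\<not> t \<le> 0"
  obtains C where "prime_cone C" "t \<notin> C"
proof -
  define cone where "cone C \<longleftrightarrow> 0 \<in> C \<and> (\<forall>x\<in>C. \<forall>y\<le>x. y \<in> C) \<and>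
    (\<forall>x\<in>C. \<forall>y\<in>C. x + y \<in> C) \<and> (\<forall>x\<in>C. sup x 0 \<in> C)" for C :: "'a set"
  define \<A> where "\<A> = {C. cone C \<and> t \<notin> C}"
  have base: "{x. x \<le> 0} \<in> \<A>"
    using assms unfolding \<A>_def cone_def by (auto intro: add_nonpos_nonpos)
  have "\<exists>C\<in>\<A>. \<forall>D\<in>\<A>. C \<subseteq> D \<longrightarrow> D = C"
  proof (rule subset_Zorn_nonempty)
    show "\<A> \<noteq> {}" using base by blast
  next
    fix \<C> assume ne: "\<C> \<noteq> {}" and ch: "subset.chain \<A> \<C>"
    have c: "cone C" "t \<notin> C" if "C \<in> \<C>" for C
      using ch that unfolding subset.chain_def \<A>_def by auto
    have lin: "C \<subseteq> D \<or> D \<subseteq> C" if "C \<in> \<C>" "D \<in> \<C>" for C D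
      using ch that unfolding subset_chain_def by auto
    have "x + y \<in> \<Union>\<C>" if xy: "x \<in> \<Union>\<C>" "y \<in> \<Union>\<C>" for x y
    proof -
      obtain C where C: "C \<in> \<C>" "x \<in> C" using xy by blast
      obtain D where D: "D \<in> \<C>" "y \<in> D" using xy by blast
      from C D obtain B where "B \<in> \<C>" "x \<in> B" "y \<in> B" using lin[of C D] by blast
      then show ?thesis using c(1)[of B] unfolding cone_def by blast
    qed
    moreover have "0 \<in> \<Union>\<C>" using ne c(1) unfolding cone_def by blast
    moreover have "y \<in> \<Union>\<C>" if "x \<in> \<Union>\<C>" "y \<le> x" for x y
      using that c(1) unfolding cone_def by blast
    moreover have "sup x 0 \<in> \<Union>\<C>" if "x \<in> \<Union>\<C>" for x
      using that c(1) unfolding cone_def by blast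
    ultimately have "cone (\<Union>\<C>)" unfolding cone_def by blast
    then show "\<Union>\<C> \<in> \<A>" using c(2) unfolding \<A>_def by blast
  qed
  then obtain C where CA: "C \<in> \<A>" and max: "\<And>D. D \<in> \<A> \<Longrightarrow> C \<subseteq> D \<Longrightarrow> D = C" by blast
  have C: "0 \<in> C" "\<And>x y. x \<in> C \<Longrightarrow> y \<le> x \<Longrightarrow> y \<in> C" "\<And>x y. x \<in> C \<Longrightarrow> y \<in> C \<Longrightarrow> x + y \<in> C"
    "\<And>x. x \<in> C \<Longrightarrow> sup x 0 \<in> C" and t: "t \<notin> C"
    using CA unfolding \<A>_def cone_def by blast+
  have adjoin: "\<exists>p\<in>C. \<exists>n::nat. 0 \<le> p \<and> t \<le> p + real n *\<^sub>R sup x 0" if x: "x \<notin> C" for x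
  proof -
    \<comment> \<open>This is the cone generated by C and x. Taking p nonnegative makes the upper
      bound nonnegative, so it also bounds \<open>sup z 0\<close>.\<close>
    define D where "D = {z. \<exists>p\<in>C. \<exists>n::nat. 0 \<le> p \<and> z \<le> p + real n *\<^sub>R sup x 0}"
    have "C \<subseteq> D"
    proof
      fix z assume "z \<in> C"
      then show "z \<in> D" unfolding D_def
        using C(4) by (auto intro!: bexI[of _ "sup z 0"] exI[of _ 0])
    qed
    moreover have "x \<in> D" unfolding D_def
      using C(1) by (auto intro!: bexI[of _ 0] exI[of _ 1])
    moreover have "cone D"
      unfolding cone_def
    proof (intro conjI ballI allI impI)
      show "0 \<in> D" using \<open>C \<subseteq> D\<close> C(1) by blast
    next
      fix z y assume "z \<in> D" "y \<le> z"
      then show "y \<in> D" unfolding D_def using order_trans by blast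
    next
      fix y z assume "y \<in> D" "z \<in> D"
      then obtain p q :: 'a and m n :: nat where pq: "p \<in> C" "q \<in> C" "0 \<le> p" "0 \<le> q"
        and le: "y \<le> p + real m *\<^sub>R sup x 0" "z \<le> q + real n *\<^sub>R sup x 0"
        unfolding D_def by blast
      have "y + z \<le> (p + q) + real (m + n) *\<^sub>R sup x 0"
        using add_mono[OF le] by (simp add: scaleR_add_left algebra_simps)
      then show "y + z \<in> D" unfolding D_def
        using pq C(3) add_nonneg_nonneg by blast
    next
      fix z assume "z \<in> D"
      then obtain p :: 'a and n :: nat where p: "p \<in> C" "0 \<le> p" "z \<le> p + real n *\<^sub>R sup x 0"
        unfolding D_def by blast
      then have "sup z 0 \<le> p + real n *\<^sub>R sup x 0"
        by (simp add: scaleR_nonneg_nonneg)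
      then show "sup z 0 \<in> D" unfolding D_def using p by blast
    qed
    ultimately have "t \<in> D" using max[of D] x unfolding \<A>_def by blast
    then show ?thesis unfolding D_def by blast
  qed
  have "x \<in> C \<or> y \<in> C" if xy: "inf x y \<in> C" for x y
  proof (rule ccontr)
    assume "\<not> ?thesis"
    then obtain p q :: 'a and m n :: nat where pq: "p \<in> C" "q \<in> C" "0 \<le> p" "0 \<le> q"
      and le: "t \<le> p + real m *\<^sub>R sup x 0" "t \<le> q + real n *\<^sub>R sup y 0"
      using adjoin by meson
    \<comment> \<open>One positive multiplier serves both bounds. Since p and q are nonnegative,
      subtracting both from t preserves each bound, so r / k lies below the positive parts of x and
      of y.\<close>
    define k where "k = Suc (m + n)"
    define r where "r = t - (p + q)"
    have "real m *\<^sub>R sup x 0 \<le> real k *\<^sub>R sup x 0" "real n *\<^sub>R sup y 0 \<le> real k *\<^sub>R sup y 0"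
      unfolding k_def by (auto intro!: scaleR_right_mono)
    moreover have "r \<le> t - p" "r \<le> t - q" using pq by (simp_all add: r_def algebra_simps)
    ultimately have "r \<le> real k *\<^sub>R sup x 0" "r \<le> real k *\<^sub>R sup y 0"
      using le by (smt (verit) add.commute diff_le_eq order_trans)+
    then have "inverse (real k) *\<^sub>R r \<le> sup x 0" "inverse (real k) *\<^sub>R r \<le> sup y 0"
      by (simp_all add: pos_le_divideR_eq k_def divideR_right pos_divideR_le_eq)
    then have "inverse (real k) *\<^sub>R r \<le> sup (inf x y) 0"
      by (rule le_sup_inf_zero)
    then have 1: "inverse (real k) *\<^sub>R r \<in> C" using C(2,4) xy by blast
    have mult: "real j *\<^sub>R z \<in> C" if "z \<in> C" for z and j :: nat
    proof (induction j)
      case 0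
      then show ?case using C(1) by simp
    next
      case (Suc j)
      then show ?case using C(3)[OF that Suc] by (simp add: scaleR_add_left)
    qed
    have "r \<in> C" using mult[OF 1, of k] by (simp add: k_def)
    then have "r + (p + q) \<in> C" using C(3) pq by blast
    then show False using t by (simp add: r_def)
  qed
  then have "prime_cone C" unfolding prime_cone_def using C by blast
  then show ?thesis using that t by blast
qed

section \<open>Order arithmetic modulo a prime cone\<close>

context
  fixes C :: "'a::riesz_space set"
  assumes C: "prime_cone C"
begin

lemma prime_cone_nonpos: "x \<le> 0 \<Longrightarrow> x \<in> C"
  and prime_cone_mono: "x \<in> C \<Longrightarrow> y \<le> x \<Longrightarrow> y \<in> C"
  and prime_cone_add: "x \<in> C \<Longrightarrow> y \<in> C \<Longrightarrow> x + y \<in> C"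
  and prime_cone_inf: "inf x y \<in> C \<Longrightarrow> x \<in> C \<or> y \<in> C"
  using C unfolding prime_cone_def by blast+

lemma prime_cone_le_trans: "x - y \<in> C \<Longrightarrow> y - z \<in> C \<Longrightarrow> x - z \<in> C"
  using prime_cone_add[of "x - y" "y - z"] by simp

text \<open>Primeness makes the quotient totally ordered, because \<open>inf x (- x)\<close> is at
  most half of x + (- x) = 0.\<close>

lemma prime_cone_total: "x \<in> C \<or> - x \<in> C"
proof -
  have "inf x (- x) \<le> 0" using add_mono[OF inf.cobounded1[of x "- x"] inf.cobounded2[of x "- x"]]
    by (simp add: double_add_le_zero_iff_single_add_le_zero)
  then show ?thesis using prime_cone_inf prime_cone_nonpos by blast
qed

lemma prime_cone_sup:
  assumes "x \<in> C" "y \<in> C" shows "sup x y \<in> C"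
proof -
  have "sup x 0 + sup y 0 \<in> C"
    using assms C unfolding prime_cone_def by blast
  moreover have "sup x y \<le> sup x 0 + sup y 0"
    by (simp add: add_increasing add_increasing2)
  ultimately show ?thesis using prime_cone_mono by blast
qed

text \<open>Closure under addition yields natural multiples only. For the positive part of x, a real
  multiple is dominated by a natural one.\<close>

lemma prime_cone_scaleR:
  assumes "x \<in> C" "0 \<le> c" shows "c *\<^sub>R x \<in> C"
proof -
  have p: "sup x 0 \<in> C" using C assms unfolding prime_cone_def by blast
  have mult: "real j *\<^sub>R sup x 0 \<in> C" for j :: nat
  proof (induction j)
    case 0
    then show ?case using prime_cone_nonpos by simp
  next
    case (Suc j)
    then show ?case using prime_cone_add[OF p Suc] by (simp add: scaleR_add_left)
  qed
  obtain n :: nat where "c \<le> real n" using real_arch_simple by blast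
  then have "c *\<^sub>R sup x 0 \<le> real n *\<^sub>R sup x 0" by (simp add: scaleR_right_mono)
  moreover have "c *\<^sub>R x \<le> c *\<^sub>R sup x 0" using assms by (simp add: scaleR_left_mono)
  ultimately show ?thesis using mult prime_cone_mono by blast
qed

text \<open>The quotient may contain infinitesimals, so p need not equal a real multiple of u there.
  It is instead located up to d by a point of the cut S lying within d of its supremum.\<close>

lemma prime_cone_approx:
  assumes u: "u \<notin> C" "0 \<le> u" and p: "- (m *\<^sub>R u) \<le> p" "p \<le> m *\<^sub>R u" and "0 < d"
  obtains a where "p - a *\<^sub>R u \<notin> C" "p - (a + d) *\<^sub>R u \<in> C"
proof -
  define S where "S = {c. p - c *\<^sub>R u \<notin> C}"
  have "- m - 1 \<in> S"
  proof -
    have "u \<le> p - (- m - 1) *\<^sub>R u" using add_right_mono[OF p(1), of "m *\<^sub>R u"] by (simp add: algebra_simps)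
    then show ?thesis unfolding S_def using u prime_cone_mono by blast
  qed
  moreover have "c \<le> m" if "c \<in> S" for c
  proof (rule ccontr)
    assume "\<not> c \<le> m"
    then have "m *\<^sub>R u \<le> c *\<^sub>R u" using u by (simp add: scaleR_right_mono)
    then have "p \<le> c *\<^sub>R u" using p order_trans by blast
    then show False using that prime_cone_nonpos unfolding S_def by simp
  qed
  ultimately have S: "S \<noteq> {}" "bdd_above S" by (auto simp: bdd_above_def)
  then obtain a where a: "a \<in> S" "Sup S - d < a"
    using less_cSup_iff[of S "Sup S - d"] \<open>0 < d\<close> by auto
  then have "a + d \<notin> S" using cSup_upper[OF _ S(2), of "a + d"] by auto
  then show ?thesis using that[of a] a unfolding S_def by auto
qed

end

section \<open>Lattice homomorphisms and steep elements\<close>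

lemma lattice_homomorphism_mono:
  assumes "lattice_homomorphism T" "x \<le> y" shows "T x \<le> T y"
  using assms unfolding lattice_homomorphism_def by (metis inf.absorb_iff1 inf.orderI)

lemma lattice_homomorphism_dual:
  assumes "lattice_homomorphism T" shows "lattice_homomorphism (\<lambda>x. - T (- x))"
  using assms unfolding lattice_homomorphism_def
  by (simp add: neg_sup_eq_inf neg_inf_eq_sup)

text \<open>If the steep element w had nonpositive image, both T g and T w would be at most m T e in
  the quotient. But \<open>sup g w\<close> dominates the average of g and w, a multiple of e that
  grows with n.\<close>

lemma steep_positive:
  fixes T :: "'a::riesz_space \<Rightarrow> 'b::riesz_space"
  assumes T: "lattice_homomorphism T" and e: "0 \<le> e"
    and hom: "\<And>c::real. T (c *\<^sub>R e) = c *\<^sub>R T e"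
    and C: "prime_cone C" and u: "T e \<notin> C"
    and x: "T x - a' *\<^sub>R T e \<notin> C" and a: "a < a'"
  shows "\<forall>\<^sub>F n in sequentially. T (real n *\<^sub>R (x - a *\<^sub>R e)) \<notin> C"
proof -
  \<comment> \<open>m is at least a', the bound on T g, and at least 0, the bound on T w. N is
    chosen so that the average of g and w is at least (m + 1) e for all n \<ge> N.\<close>
  define m where "m = max a' 0"
  obtain N :: nat where N: "(2 * m + 2 - a') / (a' - a) \<le> real N" using real_arch_simple by blast
  have "T (real n *\<^sub>R (x - a *\<^sub>R e)) \<notin> C" if "n \<ge> N" for n
  proof
    define w where "w = real n *\<^sub>R (x - a *\<^sub>R e)"
    define g where "g = real n *\<^sub>R (a' *\<^sub>R e - x) + a' *\<^sub>R e"
    assume "T (real n *\<^sub>R (x - a *\<^sub>R e)) \<in> C"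
    then have w: "T w \<in> C" unfolding w_def .
    have u0: "0 \<le> T e" using lattice_homomorphism_mono[OF T e] hom[of 0] by simp
    have "(2 * m + 2 - a') / (a' - a) \<le> real n" using N that by (meson of_nat_mono order_trans)
    then have n: "m + 1 \<le> (real n * (a' - a) + a') / 2" using a by (simp add: field_simps)
    have low: "inf g x \<le> a' *\<^sub>R e"
    proof -
      \<comment> \<open>One copy of the excess is bounded through g and n copies through x. The two
        bounds are opposite, so 1 + n copies are at most 0.\<close>
      let ?i = "inf g x - a' *\<^sub>R e"
      have "?i \<le> g - a' *\<^sub>R e" by (intro diff_right_mono) simp
      then have "?i \<le> real n *\<^sub>R (a' *\<^sub>R e - x)" by (simp add: g_def)
      moreover have "real n *\<^sub>R ?i \<le> real n *\<^sub>R (x - a' *\<^sub>R e)"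
        by (intro scaleR_left_mono) auto
      ultimately have "?i + real n *\<^sub>R ?i \<le> real n *\<^sub>R (a' *\<^sub>R e - x) + real n *\<^sub>R (x - a' *\<^sub>R e)"
        by (rule add_mono)
      also have "\<dots> = 0" by (simp add: algebra_simps)
      finally have "(1 + real n) *\<^sub>R ?i \<le> 0" by (simp add: scaleR_add_left)
      then have "?i \<le> 0" by (simp add: scaleR_le_0_iff)
      then show ?thesis by simp
    qed
    have high: "((real n * (a' - a) + a') / 2) *\<^sub>R e \<le> sup g w"
    proof -
      have "g + w = (real n * (a' - a) + a') *\<^sub>R e"
        by (simp add: g_def w_def algebra_simps)
      moreover have "g + w \<le> 2 *\<^sub>R sup g w"
        unfolding scaleR_2 by (intro add_mono) auto
      ultimately have "(1/2) *\<^sub>R ((real n * (a' - a) + a') *\<^sub>R e) \<le> (1/2) *\<^sub>R (2 *\<^sub>R sup g w)"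
        by (intro scaleR_left_mono) auto
      then show ?thesis by simp
    qed
    have "inf (T g) (T x) \<le> a' *\<^sub>R T e"
      using lattice_homomorphism_mono[OF T low] T hom unfolding lattice_homomorphism_def by simp
    \<comment> \<open>T x exceeds a' T e in the quotient, so primeness leaves T g as the one that is
      at most a' T e.\<close>
    then have "inf (T g - a' *\<^sub>R T e) (T x - a' *\<^sub>R T e) \<le> 0"
      by (metis add_inf_distrib_right diff_conv_add_uminus diff_le_0_iff_le)
    then have "T g - a' *\<^sub>R T e \<in> C"
      using x prime_cone_inf[OF C] prime_cone_nonpos[OF C] by blast
    moreover have "a' *\<^sub>R T e - m *\<^sub>R T e \<in> C"
      using prime_cone_nonpos[OF C] u0 by (simp add: m_def scaleR_right_mono)
    ultimately have 1: "T g - m *\<^sub>R T e \<in> C" by (rule prime_cone_le_trans[OF C])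
    have "T w - m *\<^sub>R T e \<le> T w" using u0 by (simp add: m_def scaleR_nonneg_nonneg)
    then have "T w - m *\<^sub>R T e \<in> C" using w prime_cone_mono[OF C] by blast
    with 1 have 2: "sup (T g - m *\<^sub>R T e) (T w - m *\<^sub>R T e) \<in> C" by (rule prime_cone_sup[OF C])
    have "(m + 1) *\<^sub>R T e \<le> ((real n * (a' - a) + a') / 2) *\<^sub>R T e"
      using n u0 by (rule scaleR_right_mono)
    also have "\<dots> \<le> sup (T g) (T w)"
      using lattice_homomorphism_mono[OF T high] T hom unfolding lattice_homomorphism_def by simp
    finally have "(m + 1) *\<^sub>R T e - m *\<^sub>R T e \<le> sup (T g) (T w) - m *\<^sub>R T e"
      by (rule diff_right_mono)
    also have "\<dots> = sup (T g - m *\<^sub>R T e) (T w - m *\<^sub>R T e)"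
      by (metis add_sup_distrib_right diff_conv_add_uminus)
    finally have "T e \<le> sup (T g - m *\<^sub>R T e) (T w - m *\<^sub>R T e)"
      by (simp add: scaleR_add_left)
    then show False using 2 u prime_cone_mono[OF C] by blast
  qed
  then show ?thesis unfolding eventually_sequentially by blast
qed

section \<open>Superadditivity\<close>

lemma lattice_homomorphism_superadditive:
  fixes T :: "'a::riesz_space \<Rightarrow> 'b::archimedean_riesz_space"
  assumes e: "strong_order_unit e" and T: "lattice_homomorphism T"
    and hom: "\<And>c::real. T (c *\<^sub>R e) = c *\<^sub>R T e"
  shows "T x + T y \<le> T (x + y)"
proof (rule ccontr)
  define u where "u = T e"
  define t where "t = T x + T y - T (x + y)"
  have e0: "0 \<le> e" using e unfolding strong_order_unit_def by blast
  have u0: "0 \<le> u" using lattice_homomorphism_mono[OF T e0] hom[of 0] by (simp add: u_def)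
  assume "\<not> ?thesis"
  then have t: "\<not> t \<le> 0" by (simp add: t_def)
  \<comment> \<open>The Archimedean axiom makes the defect t exceed a real multiple d u somewhere.
    Separating t - d u rather than t leaves a margin d in the quotient for the approximations
    below.\<close>
  have "\<exists>n::nat. \<not> real n *\<^sub>R sup t 0 \<le> u"
    using archimedean[of "sup t 0" u] t by (metis sup.cobounded1 sup.cobounded2)
  then obtain n :: nat where n: "\<not> real n *\<^sub>R sup t 0 \<le> u" by blast
  then have n0: "0 < real n" using u0 by (cases n) auto
  define d where "d = inverse (real n)"
  have d0: "0 < d" using n0 by (simp add: d_def)
  have "\<not> t \<le> d *\<^sub>R u"
  proof
    assume "t \<le> d *\<^sub>R u"
    then have "sup t 0 \<le> d *\<^sub>R u" using u0 d0 by (simp add: scaleR_nonneg_nonneg)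
    then have "real n *\<^sub>R sup t 0 \<le> real n *\<^sub>R (d *\<^sub>R u)" by (rule scaleR_left_mono) simp
    then show False using n n0 by (simp add: d_def)
  qed
  then have "\<not> t - d *\<^sub>R u \<le> 0" by simp
  then obtain C where C: "prime_cone C" and tC: "t - d *\<^sub>R u \<notin> C"
    by (rule prime_cone_exists)
  have bound: "\<exists>m\<ge>0. - (m *\<^sub>R u) \<le> T z \<and> T z \<le> m *\<^sub>R u" for z
  proof -
    obtain m where m: "0 \<le> m" "\<bar>z\<bar> \<le> m *\<^sub>R e" using e unfolding strong_order_unit_def by blast
    then have "z \<le> m *\<^sub>R e" "(- m) *\<^sub>R e \<le> z"
      using abs_le_D1 abs_le_D2 minus_le_iff by (auto, fastforce)
    then have "T z \<le> m *\<^sub>R u" "(- m) *\<^sub>R u \<le> T z"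
      using lattice_homomorphism_mono[OF T] hom unfolding u_def by metis+
    then show ?thesis using m by auto
  qed
  \<comment> \<open>If u vanished in the quotient, the whole range of T would vanish with it, and so
    would t.\<close>
  have uC: "u \<notin> C"
  proof
    assume "u \<in> C"
    then have "T z \<in> C" "- T z \<in> C" for z
      using bound[of z] prime_cone_scaleR[OF C] prime_cone_mono[OF C] by (metis minus_le_iff)+
    then have "T x + T y + (- T (x + y)) \<in> C" by (intro prime_cone_add[OF C])
    moreover have "t - d *\<^sub>R u \<le> T x + T y + (- T (x + y))"
      using u0 d0 by (simp add: t_def scaleR_nonneg_nonneg)
    ultimately show False using tC prime_cone_mono[OF C] by blast
  qed
  have d4: "0 < d / 4" using d0 by simp
  obtain a where a: "T x - a *\<^sub>R u \<notin> C" "T x - (a + d/4) *\<^sub>R u \<in> C"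
    using bound[of x] prime_cone_approx[OF C uC u0 _ _ d4] by metis
  obtain b where b: "T y - b *\<^sub>R u \<notin> C" "T y - (b + d/4) *\<^sub>R u \<in> C"
    using bound[of y] prime_cone_approx[OF C uC u0 _ _ d4] by metis
  \<comment> \<open>Locating T x and T y costs d/4 each. Three shifts by d/8 supply the strict gaps
    for \<open>steep_positive\<close> at x, at y and, dually, at z. The total 7d/8 stays below
    d.\<close>
  define a1 where "a1 = a - d/8"
  define b1 where "b1 = b - d/8"
  define z where "z = x + y"
  \<comment> \<open>Since T (- e) = - u, this says T z < (a1 + b1 - d/8) u in the quotient, phrased
    for the dual homomorphism at - z.\<close>
  have zC: "- T (- (- z)) - (- (a1 + b1 - d/8)) *\<^sub>R (- T (- e)) \<notin> C"
  proof
    assume "- T (- (- z)) - (- (a1 + b1 - d/8)) *\<^sub>R (- T (- e)) \<in> C"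
    then have "(a1 + b1 - d/8) *\<^sub>R u - T z \<in> C"
      using hom[of "- 1"] by (simp only: u_def minus_minus scaleR_minus_left scaleR_minus_right
          scaleR_one diff_minus_eq_add add.commute diff_conv_add_uminus)
    then have "(T x - (a + d/4) *\<^sub>R u) + (T y - (b + d/4) *\<^sub>R u) +
        ((a1 + b1 - d/8) *\<^sub>R u - T z) \<in> C"
      using a b prime_cone_add[OF C] by blast
    also have "(T x - (a + d/4) *\<^sub>R u) + (T y - (b + d/4) *\<^sub>R u) +
        ((a1 + b1 - d/8) *\<^sub>R u - T z) = t - (7/8 * d) *\<^sub>R u"
    proof -
      have "(a + d/4) *\<^sub>R u + (b + d/4) *\<^sub>R u - (a1 + b1 - d/8) *\<^sub>R u = (7/8 * d) *\<^sub>R u"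
        unfolding scaleR_add_left[symmetric] scaleR_diff_left[symmetric]
        by (simp add: a1_def b1_def field_simps)
      then show ?thesis unfolding t_def z_def by (simp add: algebra_simps)
    qed
    finally have "t - (7/8 * d) *\<^sub>R u \<in> C" .
    moreover have "t - d *\<^sub>R u \<le> t - (7/8 * d) *\<^sub>R u"
      using u0 d0 by (intro diff_left_mono scaleR_right_mono) auto
    ultimately show False using tC prime_cone_mono[OF C] by blast
  qed
  have "\<forall>\<^sub>F n in sequentially. T (real n *\<^sub>R (x - a1 *\<^sub>R e)) \<notin> C"
    using steep_positive[OF T e0 hom C, of x a a1] a uC d0 by (simp add: u_def a1_def)
  moreover have "\<forall>\<^sub>F n in sequentially. T (real n *\<^sub>R (y - b1 *\<^sub>R e)) \<notin> C"
    using steep_positive[OF T e0 hom C, of y b b1] b uC d0 by (simp add: u_def b1_def)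
  \<comment> \<open>The argument of T is n (z - (a1 + b1) e), so its image is eventually negative in
    the quotient.\<close>
  moreover have "\<forall>\<^sub>F n in sequentially. - T (- (real n *\<^sub>R (- z - (- (a1 + b1)) *\<^sub>R e))) \<notin> C"
  proof (rule steep_positive[OF lattice_homomorphism_dual[OF T] e0 _ C _ zC])
    show "- T (- (c *\<^sub>R e)) = c *\<^sub>R (- T (- e))" for c
      using hom[of "- c"] hom[of "- 1"] by simp
    show "- T (- e) \<notin> C" using uC hom[of "- 1"] by (simp add: u_def)
    show "- (a1 + b1) < - (a1 + b1 - d/8)" using d0 by simp
  qed
  ultimately obtain L M N where
      "\<And>n. n \<ge> L \<Longrightarrow> T (real n *\<^sub>R (x - a1 *\<^sub>R e)) \<notin> C"
      "\<And>n. n \<ge> M \<Longrightarrow> T (real n *\<^sub>R (y - b1 *\<^sub>R e)) \<notin> C"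
      "\<And>n. n \<ge> N \<Longrightarrow> - T (- (real n *\<^sub>R (- z - (- (a1 + b1)) *\<^sub>R e))) \<notin> C"
    unfolding eventually_sequentially by blast
  \<comment> \<open>The factor 2n for p and q matches the factor n for s, because
    \<open>inf p q\<close> is at most (p + q) / 2 = s.\<close>
  moreover obtain n where "2 * n \<ge> L" "2 * n \<ge> M" "n \<ge> N"
    using that[of "L + M + N"] by simp
  ultimately have n: "T (real (2 * n) *\<^sub>R (x - a1 *\<^sub>R e)) \<notin> C"
      "T (real (2 * n) *\<^sub>R (y - b1 *\<^sub>R e)) \<notin> C"
      "- T (- (real n *\<^sub>R (- z - (- (a1 + b1)) *\<^sub>R e))) \<notin> C"
    by blast+
  define p where "p = real (2 * n) *\<^sub>R (x - a1 *\<^sub>R e)"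
  define q where "q = real (2 * n) *\<^sub>R (y - b1 *\<^sub>R e)"
  define s where "s = real n *\<^sub>R (z - (a1 + b1) *\<^sub>R e)"
  have "p + q = 2 *\<^sub>R s" by (simp add: p_def q_def s_def z_def algebra_simps)
  moreover have "2 *\<^sub>R inf p q \<le> p + q" unfolding scaleR_2 by (intro add_mono) auto
  ultimately have "2 *\<^sub>R inf p q \<le> 2 *\<^sub>R s" by (simp only:)
  then have "(1/2) *\<^sub>R (2 *\<^sub>R inf p q) \<le> (1/2) *\<^sub>R (2 *\<^sub>R s)"
    by (rule scaleR_left_mono) simp
  then have "inf (T p) (T q) \<le> T s"
    using lattice_homomorphism_mono[OF T, of "inf p q" s] T
    unfolding lattice_homomorphism_def by simp
  moreover have "- T s \<notin> C" using n(3) by (simp add: s_def algebra_simps)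
  then have "T s \<in> C" using prime_cone_total[OF C] by blast
  ultimately have "inf (T p) (T q) \<in> C" using prime_cone_mono[OF C] by blast
  then show False using n(1,2) prime_cone_inf[OF C] unfolding p_def q_def by blast
qed

section \<open>From additivity to linearity\<close>

text \<open>For x \<ge> 0 and k the integer part of n c, both T (n c x) and n c T x lie between k T
  x and (k + 1) T x. Hence n times the homogeneity defect v is bounded by T x in modulus for every
  n, and the Archimedean axiom gives v = 0.\<close>

lemma additive_mono_imp_linear:
  fixes T :: "'a::riesz_space \<Rightarrow> 'b::archimedean_riesz_space"
  assumes add: "\<And>x y. T (x + y) = T x + T y" and mono: "\<And>x y. x \<le> y \<Longrightarrow> T x \<le> T y"
  shows "linear T"
proof -
  have T0: "T 0 = 0" using add[of 0 0] by simp
  have neg: "T (- x) = - T x" for x using add[of x "- x"] T0 by (simp add: eq_neg_iff_add_eq_0 add.commute)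
  have nat: "T (real n *\<^sub>R x) = real n *\<^sub>R T x" for n x
    by (induction n) (simp_all add: T0 add scaleR_add_left)
  have pos: "T (c *\<^sub>R x) = c *\<^sub>R T x" if c: "0 \<le> c" and x: "0 \<le> x" for c x
  proof -
    define v where "v = T (c *\<^sub>R x) - c *\<^sub>R T x"
    have Tx: "0 \<le> T x" using mono[OF x] T0 by simp
    have nv: "real n *\<^sub>R v \<le> T x \<and> real n *\<^sub>R (- v) \<le> T x" for n
    proof -
      define k where "k = nat \<lfloor>real n * c\<rfloor>"
      have k: "real k \<le> real n * c" "real n * c \<le> real (Suc k)"
        using c unfolding k_def by (simp_all, linarith+)
      have r: "real n *\<^sub>R v = T ((real n * c) *\<^sub>R x) - (real n * c) *\<^sub>R T x"
        using nat[of n "c *\<^sub>R x"] by (simp add: v_def scaleR_diff_right)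
      have 1: "real k *\<^sub>R T x \<le> T ((real n * c) *\<^sub>R x)"
        using mono[OF scaleR_right_mono[OF k(1) x]] by (simp add: nat)
      have 2: "T ((real n * c) *\<^sub>R x) \<le> real (Suc k) *\<^sub>R T x"
        using mono[OF scaleR_right_mono[OF k(2) x]] by (simp only: nat)
      have 3: "real k *\<^sub>R T x \<le> (real n * c) *\<^sub>R T x" "(real n * c) *\<^sub>R T x \<le> real (Suc k) *\<^sub>R T x"
        using scaleR_right_mono[OF k(1) Tx] scaleR_right_mono[OF k(2) Tx] by blast+
      have 4: "real (Suc k) *\<^sub>R T x - real k *\<^sub>R T x = T x" by (simp add: scaleR_add_left)
      show ?thesis
        using diff_mono[OF 2 3(1)] diff_mono[OF 3(2) 1] 4 by (simp add: r scaleR_minus_right)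
    qed
    have "sup v (- v) = 0"
    proof (rule archimedean)
      show "0 \<le> sup v (- v)" by (metis abs_ge_zero abs_lattice)
    next
      fix n :: nat
      show "real n *\<^sub>R sup v (- v) \<le> T x"
      proof (cases "n = 0")
        case True
        then show ?thesis using Tx by simp
      next
        case False
        then have n: "0 < real n" by simp
        \<comment> \<open>Dividing by n first lets the separate bounds on v and - v combine into one
          on their supremum.\<close>
        have "sup v (- v) \<le> inverse (real n) *\<^sub>R T x"
          using nv[of n] n by (simp add: pos_le_divideR_eq)
        then show ?thesis by (rule pos_le_divideR_eq[OF n, THEN iffD1])
      qed
    qed
    then have "\<bar>v\<bar> = 0" by (simp add: abs_lattice)
    then show ?thesis by (simp add: v_def)
  qed
  have nn: "T (c *\<^sub>R x) = c *\<^sub>R T x" if c: "0 \<le> c" for c x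
  proof -
    \<comment> \<open>Splitting into positive and negative parts removes the sign condition on x;
      the sign of c is handled afterwards by negation.\<close>
    have x: "x = sup x 0 + - sup (- x) 0"
      using prts[of x] by (simp add: pprt_def nprt_def neg_sup_eq_inf)
    have "c *\<^sub>R x = c *\<^sub>R sup x 0 + - (c *\<^sub>R sup (- x) 0)"
      using arg_cong[OF x, of "scaleR c"] by (simp only: scaleR_add_right scaleR_minus_right)
    then have "T (c *\<^sub>R x) = c *\<^sub>R T (sup x 0) + - (c *\<^sub>R T (sup (- x) 0))"
      using c by (simp only: add neg pos sup.cobounded2)
    also have "\<dots> = c *\<^sub>R T x"
      using arg_cong[OF x, of T] by (simp only: add neg scaleR_add_right scaleR_minus_right)
    finally show ?thesis .
  qed
  have "T (c *\<^sub>R x) = c *\<^sub>R T x" for c x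
    using nn[of c x] nn[of "- c" x] neg[of "c *\<^sub>R x"] by (cases "0 \<le> c") auto
  then show ?thesis using add by (intro linearI)
qed

theorem theorem5:
  fixes e :: "'a::archimedean_riesz_space"
    and T :: "'a \<Rightarrow> 'b::archimedean_riesz_space"
  assumes "strong_order_unit e"
    and "lattice_homomorphism T"
    and "\<And>c::real. T (c *\<^sub>R e) = c *\<^sub>R T e"
  shows "riesz_homomorphism T"
proof -
  \<comment> \<open>Superadditivity of this dual map is subadditivity of T.\<close>
  define S where "S = (\<lambda>x. - T (- x))"
  have S: "lattice_homomorphism S" unfolding S_def using assms(2) by (rule lattice_homomorphism_dual)
  have "S (c *\<^sub>R e) = c *\<^sub>R S e" for c
    using assms(3)[of "- c"] assms(3)[of "- 1"] by (simp add: S_def)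
  then have super: "S x + S y \<le> S (x + y)" for x y
    by (rule lattice_homomorphism_superadditive[OF assms(1) S])
  have "- (T x + T y) \<le> - T (x + y)" for x y
    using super[of "- x" "- y"] by (simp add: S_def add.commute)
  then have "T (x + y) \<le> T x + T y" for x y
    by (simp only: neg_le_iff_le)
  moreover have "T x + T y \<le> T (x + y)" for x y
    using assms by (rule lattice_homomorphism_superadditive)
  ultimately have "T (x + y) = T x + T y" for x y by (simp add: antisym)
  then have "linear T"
    using lattice_homomorphism_mono[OF assms(2)] by (rule additive_mono_imp_linear)
  then show ?thesis using assms(2) unfolding riesz_homomorphism_def by blast
qed

end
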